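(* Let $b\in\mathbf{R}^n$ satisfy $b\ge 0$ (entrywise) and $\mathbf 1^Tb=1$, and let $\lambda>0$. Let $\alpha\in(0,1)$ and $\beta\in(0,1)$ satisfy $\lambda=\log\beta/\log\alpha$. If $$\mathbf{E}\,(r^Tb)^{-\lambda}\le 1,$$ then $$\mathbf{Prob}\left(W^{\mathrm{min}}<\alpha\right)<\beta .$$
   Context: Setting (Kelly gambling). $r$ is a random vector in $\mathbf{R}^n$ with nonnegative entries (the return), $\mathbf{E}\,r_i<\infty$ for $i=1,\dots,n$, and its last entry satisfies $r_n=1$ almost surely. $\mathbf 1$ is the all-ones vector. Let $r_1,r_2,\dots$ be IID random vectors with the distribution of $r$ (here the subscript is the time index, not an entry). For a bet vector $b$ with $b\ge0$, $\mathbf 1^Tb=1$, the wealth process is $w_1=1$ and $w_t=(r_1^Tb)\cdots(r_{t-1}^Tb)$ for $t\ge 2$. The minimum wealth is the random variable $W^{\mathrm{min}}=\inf_{t=1,2,\dots}w_t$. Convention: $0^{-\lambda}=+\infty$, so that $\mathbf{E}(r^Tb)^{-\lambda}\in[0,\infty]$. *)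

theory Defs
  imports "HOL-Probability.Probability"
begin

(* x to the power -lam in [0, \<infinity>].  The library has 0 powr a = 0, so the convention
   that a negative power of 0 is infinite must be built in. *)
definition neg_power :: "real \<Rightarrow> real \<Rightarrow> ennreal" where
  "neg_power lam x = (if x = 0 then \<infinity> else ennreal (x powr (- lam)))"

definition wealth ::
  "real ^ 'n \<Rightarrow> (nat \<Rightarrow> 'a \<Rightarrow> real ^ 'n) \<Rightarrow> nat \<Rightarrow> 'a \<Rightarrow> real" where
  "wealth b R t \<omega> = (\<Prod>s\<in>{1..<t}. R s \<omega> \<bullet> b)"

(* The returns are nonnegative only almost surely, so on a null set the wealth may be
   unbounded below, where Inf on type real is meaningless; hence the infimum is taken
   in the extended reals.  Almost surely it is the real infimum, with a value in [0, 1]. *)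
definition min_wealth ::
  "real ^ 'n \<Rightarrow> (nat \<Rightarrow> 'a \<Rightarrow> real ^ 'n) \<Rightarrow> 'a \<Rightarrow> ereal" where
  "min_wealth b R \<omega> = (INF t\<in>{1..}. ereal (wealth b R t \<omega>))"

end

theory Submission
  imports Defs
begin

text \<open>
  The process \<open>w\<^sub>t\<close> to the power \<open>-\<lambda>\<close> is a nonnegative supermartingale with initial value 1, and
  \<open>w\<^sub>t < \<alpha>\<close> means that it exceeds \<open>1/\<beta>\<close>. Stop it at the first such time. The stopped value has
  expectation at most 1 and is strictly larger than \<open>1/\<beta>\<close> on the event in question, so Markov's
  inequality is strict there.
\<close>

text \<open>The running product \<open>y 1 * ... * y n\<close>, frozen at its first value above
  \<open>c\<close>. The overshooting value itself is kept, so a frozen product stays strictly above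
  \<open>c\<close>. The recursion encodes the stopping rule without a stopping time.\<close>

primrec stopped_prod :: "'a::{linorder,comm_monoid_mult} \<Rightarrow> (nat \<Rightarrow> 'a) \<Rightarrow> nat \<Rightarrow> 'a" where
  "stopped_prod c y 0 = 1"
| "stopped_prod c y (Suc n) =
    (if c < stopped_prod c y n then stopped_prod c y n else stopped_prod c y n * y (Suc n))"

lemma stopped_prod_cong:
  assumes "\<And>i. i \<in> {1..n} \<Longrightarrow> x i = y i"
  shows "stopped_prod c x n = stopped_prod c y n"
  using assms by (induction n) auto

text \<open>Measurability in the coordinates, as opposed to in \<omega>, is what lets independence
  of coordinate blocks pass to functions of the stopped product.\<close>

lemma measurable_stopped_prod_PiM:
  fixes c :: ennreal
  assumes "{1..n} \<subseteq> I"
  shows "(\<lambda>y. stopped_prod c y n) \<in> borel_measurable (PiM I (\<lambda>_. borel))"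
  using assms
proof (induction n)
  case (Suc n)
  have "{1..n} \<subseteq> I" and "Suc n \<in> I" using Suc.prems by auto
  note [measurable] = Suc.IH[OF \<open>{1..n} \<subseteq> I\<close>] measurable_component_singleton[OF \<open>Suc n \<in> I\<close>]
  show ?case by simp
qed simp

lemma measurable_stopped_prod:
  fixes c :: ennreal
  assumes "\<And>i. 1 \<le> i \<Longrightarrow> Y i \<in> borel_measurable M"
  shows "(\<lambda>\<omega>. stopped_prod c (\<lambda>i. Y i \<omega>) n) \<in> borel_measurable M"
proof (induction n)
  case (Suc n)
  note [measurable] = Suc.IH assms[of "Suc n", simplified]
  show ?case by simp
qed simp

text \<open>If the stopped product never passed \<open>c\<close>, it would never freeze and would
  equal the plain product at every index.\<close>

lemma exceeds_stopped_prod: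
  assumes "c < prod y {1..n}"
  shows "\<exists>n. c < stopped_prod c y n"
proof (rule ccontr)
  assume never: "\<not> ?thesis"
  have "stopped_prod c y m = prod y {1..m}" for m
  proof (induction m)
    case (Suc m)
    then have "\<not> c < prod y {1..m}" using never by metis
    with Suc.IH show ?case by (simp add: mult.commute)
  qed simp
  then show False using never assms by metis
qed

text \<open>A pair is a family indexed by \<open>bool\<close>, so the product rule for independent
  families applies. Values in \<open>ennreal\<close> allow infinite expectations.\<close>

lemma (in prob_space) indep_var_nn_integral_mult:
  fixes X Y :: "'a \<Rightarrow> ennreal"
  assumes "indep_var borel X borel Y"
  shows "(\<integral>\<^sup>+\<omega>. X \<omega> * Y \<omega> \<partial>M) = (\<integral>\<^sup>+\<omega>. X \<omega> \<partial>M) * (\<integral>\<^sup>+\<omega>. Y \<omega> \<partial>M)"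
proof -
  have "case_bool borel borel = (\<lambda>_. borel :: ennreal measure)"
    by (auto split: bool.split)
  then have "indep_vars (\<lambda>_. borel) (case_bool X Y) UNIV"
    using assms by (simp add: indep_var_def)
  from indep_vars_nn_integral[OF _ this] show ?thesis
    by (simp add: UNIV_bool mult.commute)
qed

text \<open>Supermartingale step: where the product is frozen nothing changes; elsewhere it is
  multiplied by an independent factor of mean at most 1.\<close>

lemma (in prob_space) nn_integral_stopped_prod_le_1:
  fixes Y :: "nat \<Rightarrow> 'a \<Rightarrow> ennreal"
  assumes indep: "indep_vars (\<lambda>_. borel) Y {1..}"
    and le1: "\<And>i. 1 \<le> i \<Longrightarrow> (\<integral>\<^sup>+\<omega>. Y i \<omega> \<partial>M) \<le> 1"
  shows "(\<integral>\<^sup>+\<omega>. stopped_prod c (\<lambda>i. Y i \<omega>) n \<partial>M) \<le> 1"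
proof (induction n)
  case 0
  show ?case by (simp add: emeasure_space_1)
next
  case (Suc n)
  have Y: "Y i \<in> borel_measurable M" if "1 \<le> i" for i
    using indep that by (auto simp: indep_vars_def)
  let ?V = "\<lambda>\<omega>. stopped_prod c (\<lambda>i. Y i \<omega>) n"
  note [measurable] = measurable_stopped_prod[OF Y, of _ c n] Y[of "Suc n", simplified]
  \<comment> \<open>The part of the stopped product that is still running: zero once frozen, and a
    function of the first \<open>n\<close> factors only.\<close>
  define f where "f y = (if c < stopped_prod c y n then 0 else stopped_prod c y n)" for y
  have f[measurable]: "f \<in> borel_measurable (PiM {1..n} (\<lambda>_. borel))"
  proof -
    note V = measurable_stopped_prod_PiM[OF order.refl, of c n]
    show ?thesis unfolding f_def[abs_def]
      by (intro measurable_If V borel_measurable_const borel_measurable_less)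
  qed
  \<comment> \<open>Independence is available for the restrictions of the family to the disjoint
    blocks \<open>{1..n}\<close> and \<open>{Suc n}\<close>; restricting does not change
    \<open>f\<close>.\<close>
  have frestrict: "f (restrict y {1..n}) = f y" for y
    using stopped_prod_cong[of n "restrict y {1..n}" y c] by (simp add: f_def)
  have "indep_var borel (f \<circ> (\<lambda>\<omega>. restrict (\<lambda>i. Y i \<omega>) {1..n}))
      borel ((\<lambda>y. y (Suc n)) \<circ> (\<lambda>\<omega>. restrict (\<lambda>i. Y i \<omega>) {Suc n}))"
    by (rule indep_var_compose[OF indep_var_restrict[OF indep]]) (use f in auto)
  then have ind: "indep_var borel (\<lambda>\<omega>. f (\<lambda>i. Y i \<omega>)) borel (Y (Suc n))"
    unfolding comp_def frestrict by simp
  have fY[measurable]: "(\<lambda>\<omega>. f (\<lambda>i. Y i \<omega>)) \<in> borel_measurable M"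
    unfolding f_def by measurable
  have "(\<integral>\<^sup>+\<omega>. stopped_prod c (\<lambda>i. Y i \<omega>) (Suc n) \<partial>M) =
      (\<integral>\<^sup>+\<omega>. (if c < ?V \<omega> then ?V \<omega> else 0) + f (\<lambda>i. Y i \<omega>) * Y (Suc n) \<omega> \<partial>M)"
    by (intro nn_integral_cong) (simp add: f_def)
  also have "\<dots> = (\<integral>\<^sup>+\<omega>. (if c < ?V \<omega> then ?V \<omega> else 0) \<partial>M) +
      (\<integral>\<^sup>+\<omega>. f (\<lambda>i. Y i \<omega>) * Y (Suc n) \<omega> \<partial>M)"
    by (intro nn_integral_add) measurable
  also have "\<dots> \<le> (\<integral>\<^sup>+\<omega>. (if c < ?V \<omega> then ?V \<omega> else 0) \<partial>M) + (\<integral>\<^sup>+\<omega>. f (\<lambda>i. Y i \<omega>) \<partial>M)"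
    unfolding indep_var_nn_integral_mult[OF ind]
    using mult_left_mono[OF le1[of "Suc n"]] by (intro add_left_mono) simp
  also have "\<dots> = (\<integral>\<^sup>+\<omega>. (if c < ?V \<omega> then ?V \<omega> else 0) + f (\<lambda>i. Y i \<omega>) \<partial>M)"
    by (intro nn_integral_add[symmetric]) measurable
  also have "\<dots> = (\<integral>\<^sup>+\<omega>. ?V \<omega> \<partial>M)"
    by (intro nn_integral_cong) (simp add: f_def)
  also have "\<dots> \<le> 1" by (rule Suc.IH)
  finally show ?case .
qed

lemma (in prob_space) maximal_inequality_indep_prod:
  fixes Y :: "nat \<Rightarrow> 'a \<Rightarrow> ennreal"
  assumes indep: "indep_vars (\<lambda>_. borel) Y {1..}"
    and le1: "\<And>i. 1 \<le> i \<Longrightarrow> (\<integral>\<^sup>+\<omega>. Y i \<omega> \<partial>M) \<le> 1"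
  shows "c * emeasure M {\<omega> \<in> space M. \<exists>n. c < (\<Prod>i=1..n. Y i \<omega>)} < 1"
proof -
  have Y: "Y i \<in> borel_measurable M" if "1 \<le> i" for i
    using indep that by (auto simp: indep_vars_def)
  define V where "V n \<omega> = stopped_prod c (\<lambda>i. Y i \<omega>) n" for n \<omega>
  have [measurable]: "V n \<in> borel_measurable M" for n
    unfolding V_def using measurable_stopped_prod[OF Y] by simp
  define G where "G = {\<omega> \<in> space M. \<exists>n. c < V n \<omega>}"
  have [measurable]: "G \<in> sets M" unfolding G_def by measurable
  \<comment> \<open>\<open>V\<close> need not be monotone in \<open>n\<close>, but \<open>F\<close>
    is: it is 0 until the passage above \<open>c\<close> and constant afterwards. Monotone
    convergence therefore applies.\<close>
  define F where "F n \<omega> = (if c < V n \<omega> then V n \<omega> else 0)" for n \<omega>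
  have [measurable]: "F n \<in> borel_measurable M" for n unfolding F_def by measurable
  have "incseq F"
    by (intro incseq_SucI le_funI) (simp add: F_def V_def)
  then have "(\<integral>\<^sup>+\<omega>. (SUP n. F n \<omega>) \<partial>M) = (SUP n. \<integral>\<^sup>+\<omega>. F n \<omega> \<partial>M)"
    by (rule nn_integral_monotone_convergence_SUP) simp
  also have "\<dots> \<le> 1"
  proof (rule SUP_least)
    fix n
    have "(\<integral>\<^sup>+\<omega>. F n \<omega> \<partial>M) \<le> (\<integral>\<^sup>+\<omega>. V n \<omega> \<partial>M)"
      by (intro nn_integral_mono) (simp add: F_def)
    also have "\<dots> \<le> 1"
      unfolding V_def by (rule nn_integral_stopped_prod_le_1[OF indep le1])
    finally show "(\<integral>\<^sup>+\<omega>. F n \<omega> \<partial>M) \<le> 1" .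
  qed
  finally have F_le: "(\<integral>\<^sup>+\<omega>. (SUP n. F n \<omega>) \<partial>M) \<le> 1" .
  have less: "c < (SUP n. F n \<omega>)" if "\<omega> \<in> G" for \<omega>
  proof -
    obtain n where "c < V n \<omega>" using \<open>\<omega> \<in> G\<close> by (auto simp: G_def)
    then have "c < F n \<omega>" by (simp add: F_def)
    then show ?thesis by (auto simp: less_SUP_iff)
  qed
  have le: "c * indicator G \<omega> \<le> (SUP n. F n \<omega>)" for \<omega>
    using less[of \<omega>] by (auto simp: indicator_def intro: less_imp_le)
  have G_less: "c * emeasure M G < 1"
  proof (cases "emeasure M G = 0")
    case False
    \<comment> \<open>Two integrands with one below the other have strictly ordered integrals unless
      they agree almost everywhere, and agreement here would make \<open>G\<close> a null
      set.\<close>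
    have "\<not> (AE \<omega> in M. (SUP n. F n \<omega>) \<le> c * indicator G \<omega>)"
    proof
      assume "AE \<omega> in M. (SUP n. F n \<omega>) \<le> c * indicator G \<omega>"
      then have "AE \<omega> in M. \<omega> \<notin> G"
        by eventually_elim (use less in \<open>fastforce simp: indicator_def not_le[symmetric]\<close>)
      then show False using False by (simp add: AE_iff_measurable[OF \<open>G \<in> sets M\<close>] G_def)
    qed
    \<comment> \<open>The strict comparison also requires the smaller integral to be finite.\<close>
    moreover have "(\<integral>\<^sup>+\<omega>. c * indicator G \<omega> \<partial>M) \<noteq> \<infinity>"
      using order.trans[OF nn_integral_mono[of M, OF le] F_le] by (auto simp: top_unique)
    ultimately have "(\<integral>\<^sup>+\<omega>. c * indicator G \<omega> \<partial>M) < (\<integral>\<^sup>+\<omega>. (SUP n. F n \<omega>) \<partial>M)"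
      using le by (intro nn_integral_less) auto
    then show ?thesis using F_le by (simp add: nn_integral_cmult)
  qed simp
  have "emeasure M {\<omega> \<in> space M. \<exists>n. c < (\<Prod>i=1..n. Y i \<omega>)} \<le> emeasure M G"
    unfolding G_def V_def using exceeds_stopped_prod
    by (intro emeasure_mono) (use \<open>G \<in> sets M\<close> in \<open>auto simp: G_def V_def\<close>)
  then have "c * emeasure M {\<omega> \<in> space M. \<exists>n. c < (\<Prod>i=1..n. Y i \<omega>)} \<le> c * emeasure M G"
    by (rule mult_left_mono) simp
  with G_less show ?thesis by (rule le_less_trans[rotated])
qed

lemma measurable_neg_power [measurable]: "neg_power lam \<in> borel_measurable borel"
  unfolding neg_power_def[abs_def] by measurable

text \<open>Strict positivity keeps every factor out of the infinite branch, so the product can be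
  computed in the reals.\<close>

lemma prod_neg_power:
  assumes "\<And>i. i \<in> A \<Longrightarrow> x i > 0"
  shows "(\<Prod>i\<in>A. neg_power lam (x i)) = ennreal ((\<Prod>i\<in>A. x i) powr (- lam))"
proof -
  have "(\<Prod>i\<in>A. neg_power lam (x i)) = (\<Prod>i\<in>A. ennreal (x i powr (- lam)))"
    using assms by (intro prod.cong refl) (metis less_irrefl neg_power_def)
  then show ?thesis by (simp add: prod_ennreal prod_powr_distrib)
qed

text \<open>Wealth at time \<open>t\<close> multiplies \<open>t - 1\<close> returns, hence the shift
  \<open>t = Suc n\<close>; \<open>n = 0\<close> is the initial wealth 1.\<close>

lemma min_wealth_less_iff:
  "min_wealth b R \<omega> < ereal a \<longleftrightarrow> (\<exists>n. (\<Prod>s=1..n. R s \<omega> \<bullet> b) < a)"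
proof -
  have "min_wealth b R \<omega> < ereal a \<longleftrightarrow> (\<exists>t\<ge>1. wealth b R t \<omega> < a)"
    by (auto simp: min_wealth_def INF_less_iff)
  also have "\<dots> \<longleftrightarrow> (\<exists>n. wealth b R (Suc n) \<omega> < a)"
    by (metis One_nat_def Suc_le_D le_add1 plus_1_eq_Suc)
  finally show ?thesis by (simp add: wealth_def atLeastLessThanSuc_atLeastAtMost)
qed

theorem mainTheorem1:
  fixes N :: "'b measure" and r :: "'b \<Rightarrow> real ^ 'n::{finite,linorder}"
    and M :: "'a measure" and R :: "nat \<Rightarrow> 'a \<Rightarrow> real ^ 'n::{finite,linorder}"
    and b :: "real ^ 'n::{finite,linorder}" and lam \<alpha> \<beta> :: real
  assumes "prob_space N"
    and "r \<in> borel_measurable N"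
    and "AE x in N. \<forall>i. 0 \<le> r x $ i"
    and "\<forall>i. integrable N (\<lambda>x. r x $ i)"
    and "AE x in N. r x $ (Max UNIV) = 1"
    and "prob_space M"
    and "prob_space.indep_vars M (\<lambda>_. borel) R {1..}"
    and "\<forall>t\<ge>1. distr M borel (R t) = distr N borel r"
    and "\<forall>i. 0 \<le> b $ i"
    and "(\<Sum>i\<in>UNIV. b $ i) = 1"
    and "lam > 0"
    and "\<alpha> \<in> {0<..<1}"
    and "\<beta> \<in> {0<..<1}"
    and "lam = ln \<beta> / ln \<alpha>"
    and "(\<integral>\<^sup>+ x. neg_power lam (r x \<bullet> b) \<partial>N) \<le> 1"
  shows "\<P>(\<omega> in M. min_wealth b R \<omega> < ereal \<alpha>) < \<beta>"
proof -
  interpret N: prob_space N by fact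
  interpret M: prob_space M by fact
  note [measurable] = \<open>r \<in> borel_measurable N\<close>
  have R[measurable]: "R t \<in> borel_measurable M" if "1 \<le> t" for t
    using assms(7) that by (auto simp: M.indep_vars_def)
  define Y where "Y s \<omega> = neg_power lam (R s \<omega> \<bullet> b)" for s \<omega>
  have Y_indep: "M.indep_vars (\<lambda>_. borel) Y {1..}"
    unfolding Y_def using assms(7) by (rule M.indep_vars_compose2) measurable
  have Y_le: "(\<integral>\<^sup>+\<omega>. Y t \<omega> \<partial>M) \<le> 1" if "1 \<le> t" for t
  proof -
    have "(\<integral>\<^sup>+\<omega>. Y t \<omega> \<partial>M) = (\<integral>\<^sup>+v. neg_power lam (v \<bullet> b) \<partial>distr M borel (R t))"
      unfolding Y_def by (rule nn_integral_distr[symmetric]) (use R[OF that] in measurable)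
    also have "\<dots> = (\<integral>\<^sup>+v. neg_power lam (v \<bullet> b) \<partial>distr N borel r)"
      using assms(8) that by simp
    also have "\<dots> = (\<integral>\<^sup>+x. neg_power lam (r x \<bullet> b) \<partial>N)"
      by (rule nn_integral_distr) measurable
    finally show ?thesis using assms(15) by simp
  qed
  \<comment> \<open>A finite integral makes the integrand finite almost everywhere. As
    \<open>neg_power\<close> is infinite at 0, this rules out a zero return and gives
    positivity.\<close>
  have "AE x in N. neg_power lam (r x \<bullet> b) \<noteq> \<infinity>"
    using assms(15) by (intro nn_integral_PInf_AE) (auto simp: top_unique)
  with assms(3) have "AE x in N. 0 < r x \<bullet> b"
  proof eventually_elim
    case (elim x)
    have "0 \<le> r x \<bullet> b"
      using elim assms(9) by (auto simp: inner_vec_def intro!: sum_nonneg)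
    moreover have "r x \<bullet> b \<noteq> 0"
      using elim by (auto simp: neg_power_def)
    ultimately show ?case by simp
  qed
  then have "AE v in distr N borel r. 0 < v \<bullet> b"
    by (simp add: AE_distr_iff)
  then have "AE \<omega> in M. 0 < R t \<omega> \<bullet> b" if "1 \<le> t" for t
    using AE_distrD[OF R[OF that], of "\<lambda>v. 0 < v \<bullet> b"] assms(8)[rule_format, OF that] by metis
  then have pos: "AE \<omega> in M. \<forall>t\<ge>1. 0 < R t \<omega> \<bullet> b"
    by (auto simp: AE_all_countable)
  have \<alpha>: "0 < \<alpha>" "\<alpha> < 1" and \<beta>: "0 < \<beta>" "\<beta> < 1"
    using assms(12,13) by auto
  \<comment> \<open>The choice of \<open>lam\<close> is exactly what makes
    \<open>lam * ln \<alpha> = ln \<beta>\<close>, so wealth level \<alpha> corresponds to level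
    1/\<beta> of the transformed product.\<close>
  have "\<alpha> powr (- lam) = exp (- ln \<beta>)"
    using \<alpha> assms(14) by (simp add: powr_def)
  then have \<alpha>_powr: "\<alpha> powr (- lam) = 1 / \<beta>"
    using \<beta> by (simp add: exp_minus inverse_eq_divide)
  let ?E = "{\<omega> \<in> space M. \<exists>n. ennreal (1 / \<beta>) < (\<Prod>s=1..n. Y s \<omega>)}"
  have [measurable]: "?E \<in> sets M"
  proof -
    have "(\<lambda>\<omega>. \<Prod>s=1..n. Y s \<omega>) \<in> borel_measurable M" for n
      using Y_indep by (intro borel_measurable_prod_ennreal) (auto simp: M.indep_vars_def)
    note [measurable] = this
    show ?thesis by measurable
  qed
  \<comment> \<open>On positive reals the power \<open>- lam\<close> is strictly decreasing, so
    wealth below \<alpha> means a product of the \<open>Y s\<close> above 1/\<beta>. The inclusion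
    holds only almost surely, where all returns are positive.\<close>
  have "AE \<omega> in M. \<omega> \<in> {\<omega> \<in> space M. min_wealth b R \<omega> < ereal \<alpha>} \<longrightarrow> \<omega> \<in> ?E"
    using pos
  proof eventually_elim
    case (elim \<omega>)
    show ?case
    proof
      assume *: "\<omega> \<in> {\<omega> \<in> space M. min_wealth b R \<omega> < ereal \<alpha>}"
      then obtain n where n: "(\<Prod>s=1..n. R s \<omega> \<bullet> b) < \<alpha>"
        by (auto simp: min_wealth_less_iff)
      have "0 < (\<Prod>s=1..n. R s \<omega> \<bullet> b)"
        using elim by (intro prod_pos) auto
      then have less: "1 / \<beta> < (\<Prod>s=1..n. R s \<omega> \<bullet> b) powr (- lam)"
        using powr_less_mono2_neg[of "- lam" _ \<alpha>] n \<open>lam > 0\<close> \<alpha>_powr by simp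
      have "ennreal (1 / \<beta>) < ennreal ((\<Prod>s=1..n. R s \<omega> \<bullet> b) powr (- lam))"
        using less \<beta> by (simp add: ennreal_less_iff)
      also have "\<dots> = (\<Prod>s=1..n. Y s \<omega>)"
        unfolding Y_def using elim by (intro prod_neg_power[symmetric]) simp
      finally show "\<omega> \<in> ?E"
        using * by blast
    qed
  qed
  then have "emeasure M {\<omega> \<in> space M. min_wealth b R \<omega> < ereal \<alpha>} \<le> emeasure M ?E"
    by (rule emeasure_mono_AE) measurable
  then have le: "\<P>(\<omega> in M. min_wealth b R \<omega> < ereal \<alpha>) \<le> M.prob ?E"
    by (simp add: M.emeasure_eq_measure)
  \<comment> \<open>The maximal inequality at level 1/\<beta> supplies the strictness of the final
    bound.\<close>
  have "ennreal (1 / \<beta>) * emeasure M ?E < 1"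
    by (rule M.maximal_inequality_indep_prod[OF Y_indep Y_le])
  then have "1 / \<beta> * M.prob ?E < 1"
    using \<beta> by (simp add: M.emeasure_eq_measure flip: ennreal_mult)
  with le show ?thesis
    using \<beta> by (simp add: field_simps)
qed

end
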